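(* Assume CH. Let $\mathcal{I}$ and $\mathcal{J}$ be ideals such that $\mathcal{I}$ is unboring and $\mathcal{J}\not\leq_K\mathcal{I}|A$ for every $A\notin\mathcal{I}$. Then there is a Mr\'owka space in $\mathrm{FinBW}(\mathcal{I})\setminus\mathrm{FinBW}(\mathcal{J})$.
   Context: An ideal on an infinite countable set $X$ is a family $\mathcal{I}\subseteq\mathcal{P}(X)$ closed under subsets and finite unions, containing all finite subsets, with $X\notin\mathcal{I}$. $\mathcal{I}|A=\{B\cap A:B\in\mathcal{I}\}$. A space $X$ is in $\mathrm{FinBW}(\mathcal{I})$ if $X$ is Hausdorff and for every sequence $(x_n)_{n\in\bigcup\mathcal{I}}$ in $X$ there is $A\notin\mathcal{I}$ with $(x_n)_{n\in A}$ convergent in $X$. $\mathcal{J}\leq_K\mathcal{I}$: there is a function $f:\bigcup\mathcal{I}\to\bigcup\mathcal{J}$ with $f^{-1}[B]\in\mathcal{I}$ for all $B\in\mathcal{J}$ (for restrictions, with $\bigcup\mathcal{I}|A=A$). $\mathrm{Fin}^2$: ideal on $\omega^2$ of all $A$ with only finitely many $n$ such that $\{m:(n,m)\in A\}$ is infinite. $\mathcal{BI}$: ideal on $\omega^3$ of all $A$ for which there is $k$ with $\{(j,l):(i,j,l)\in A\}\in\mathrm{Fin}^2$ for $i<k$ and finite for $i\ge k$. $\mathcal{I}\sqsubseteq\mathcal{J}$: there is a bijection $f:\bigcup\mathcal{J}\to\bigcup\mathcal{I}$ with $f^{-1}[A]\in\mathcal{J}$ for all $A\in\mathcal{I}$.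 $\mathcal{I}$ is unboring if $\mathcal{BI}\not\sqsubseteq\mathcal{I}$. A Mr\'owka space is $\Phi(\mathcal{A})$ for an infinite almost disjoint family $\mathcal{A}$ of infinite subsets of $\omega$: underlying set $\omega\cup\mathcal{A}\cup\{\infty\}$, points of $\omega$ isolated, basic neighbourhoods of $A\in\mathcal{A}$ are $\{A\}\cup(A\setminus F)$ ($F\subseteq\omega$ finite), of $\infty$ are $\{\infty\}\cup(\mathcal{A}\setminus G)\cup(\omega\setminus(F\cup\bigcup G))$ ($F\subseteq\omega$, $G\subseteq\mathcal{A}$ finite). *)

theory Defs
  imports "HOL-Analysis.Analysis" "HOL-Library.Equipollence"
begin

definition CH :: bool where
  "CH \<longleftrightarrow> (\<forall>S::real set. countable S \<or> S \<approx> (UNIV::real set))"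

definition is_ideal :: "'a set set \<Rightarrow> bool" where
  "is_ideal I \<longleftrightarrow>
     countable (\<Union>I) \<and> infinite (\<Union>I) \<and>
     (\<forall>A\<in>I. \<forall>B. B \<subseteq> A \<longrightarrow> B \<in> I) \<and>
     (\<forall>A\<in>I. \<forall>B\<in>I. A \<union> B \<in> I) \<and>
     (\<forall>F. finite F \<and> F \<subseteq> \<Union>I \<longrightarrow> F \<in> I) \<and>
     \<Union>I \<notin> I"

definition restr_ideal :: "'a set set \<Rightarrow> 'a set \<Rightarrow> 'a set set" where
  "restr_ideal I A = (\<lambda>B. B \<inter> A) ` I"

definition katetov_le :: "'b set set \<Rightarrow> 'a set set \<Rightarrow> bool" where
  "katetov_le J I \<longleftrightarrow>
     (\<exists>f. (\<forall>x\<in>\<Union>I. f x \<in> \<Union>J) \<and> (\<forall>B\<in>J. {x\<in>\<Union>I. f x \<in> B} \<in> I))"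

definition ideal_sqsub :: "'a set set \<Rightarrow> 'b set set \<Rightarrow> bool" where
  "ideal_sqsub I J \<longleftrightarrow>
     (\<exists>f. bij_betw f (\<Union>J) (\<Union>I) \<and> (\<forall>A\<in>I. {x\<in>\<Union>J. f x \<in> A} \<in> J))"

definition Fin2 :: "(nat \<times> nat) set set" where
  "Fin2 = {A. finite {n. infinite {m. (n, m) \<in> A}}}"

definition BI :: "(nat \<times> nat \<times> nat) set set" where
  "BI = {A. \<exists>k. \<forall>i. (i < k \<longrightarrow> {(j, l). (i, j, l) \<in> A} \<in> Fin2) \<and>
                     (k \<le> i \<longrightarrow> finite {(j, l). (i, j, l) \<in> A})}"

definition unboring :: "'a set set \<Rightarrow> bool" where
  "unboring I \<longleftrightarrow> \<not> ideal_sqsub BI I"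

definition conv_on :: "'c topology \<Rightarrow> ('a \<Rightarrow> 'c) \<Rightarrow> 'a set \<Rightarrow> 'c \<Rightarrow> bool" where
  "conv_on X x A l \<longleftrightarrow> l \<in> topspace X \<and>
     (\<forall>U. openin X U \<and> l \<in> U \<longrightarrow> finite {n\<in>A. x n \<notin> U})"

definition FinBW :: "'a set set \<Rightarrow> 'c topology \<Rightarrow> bool" where
  "FinBW I X \<longleftrightarrow> Hausdorff_space X \<and>
     (\<forall>x. (\<forall>n\<in>\<Union>I. x n \<in> topspace X) \<longrightarrow>
          (\<exists>A. A \<subseteq> \<Union>I \<and> A \<notin> I \<and> (\<exists>l. conv_on X x A l)))"

definition almost_disjoint_family :: "nat set set \<Rightarrow> bool" where
  "almost_disjoint_family \<A> \<longleftrightarrow> infinite \<A> \<and> (\<forall>A\<in>\<A>. infinite A) \<and>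
     (\<forall>A\<in>\<A>. \<forall>B\<in>\<A>. A \<noteq> B \<longrightarrow> finite (A \<inter> B))"

datatype mpoint = MNat nat | MSet "nat set" | MInf

definition mrowka_basis :: "nat set set \<Rightarrow> mpoint set set" where
  "mrowka_basis \<A> =
     {{MNat n} | n. True} \<union>
     {insert (MSet A) (MNat ` (A - F)) | A F. A \<in> \<A> \<and> finite F} \<union>
     {insert MInf (MSet ` (\<A> - G) \<union> MNat ` (UNIV - (F \<union> \<Union>G))) | F G.
        finite F \<and> finite G \<and> G \<subseteq> \<A>}"

definition mrowka :: "nat set set \<Rightarrow> mpoint topology" where
  "mrowka \<A> = topology_generated_by (mrowka_basis \<A>)"

end

theory Submission
  imports Defs
begin

text \<open>Transport \<open>J\<close> to an ideal \<open>K\<close> on \<open>\<omega>\<close>.  We build a maximal almost disjoint family \<open>\<A> \<subseteq> K\<close>: since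
  \<open>K\<close> is tall, the identity sequence on \<open>\<omega>\<close> does not converge in \<open>\<Phi>(\<A>)\<close> along any set outside \<open>K\<close>, so
  \<open>\<Phi>(\<A>)\<close> is not in \<open>FinBW J\<close>.  To put it into \<open>FinBW I\<close>, enumerate the relevant sequences along the
  reals by CH and add, for each of them, one set to the countable family \<open>\<A>\<^sub>0\<close> built so far.  If no
  set works for a given sequence, split its index set into the part whose terms lie outside \<open>\<omega>\<close> or
  outside \<open>\<Union>\<A>\<^sub>0\<close>, and the parts on which the first member of \<open>\<A>\<^sub>0\<close> containing the term is the
  \<open>i\<close>-th; reading these parts as the rows of \<open>\<omega>\<^sup>3\<close> shows \<open>BI \<sqsubseteq> I\<close>, contradicting that \<open>I\<close> is
  unboring.\<close>

section \<open>Recursion of length continuum under CH\<close>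

text \<open>The cardinal order of the reals is a well-order whose proper initial segments have size
  below the continuum, so CH makes them countable. \<open>R\<close> is its strict part.\<close>

lemma CH_countable_segments:
  assumes CH
  obtains R :: "(real \<times> real) set"
  where "wf R" "\<And>t. countable {s. (s, t) \<in> R}" "\<And>s t. s \<noteq> t \<Longrightarrow> (s, t) \<in> R \<or> (t, s) \<in> R"
proof -
  let ?r = "card_of (UNIV :: real set)"
  have wo: "well_order_on UNIV ?r" and F: "Field ?r = UNIV"
    by (rule card_of_well_order_on, rule Field_card_of)
  show ?thesis
  proof
    show "wf (?r - Id)"
      using wo by (simp add: well_order_on_def)
    show "(s, t) \<in> ?r - Id \<or> (t, s) \<in> ?r - Id" if "s \<noteq> t" for s t
      using wo that F by (auto simp: well_order_on_def linear_order_on_def total_on_def)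
    show "countable {s. (s, t) \<in> ?r - Id}" for t
    proof -
      have eq: "{s. (s, t) \<in> ?r - Id} = underS ?r t"
        by (auto simp: underS_def)
      have "(card_of (underS ?r t), ?r) \<in> ordLess"
        using card_of_underS[OF card_of_Card_order, of t "UNIV :: real set"] F by simp
      then have "\<not> underS ?r t \<approx> (UNIV :: real set)"
        using not_ordLess_ordIso card_of_ordIso unfolding eqpoll_def by blast
      then show ?thesis
        using assms eq unfolding CH_def by auto
    qed
  qed
qed

text \<open>Here \<open>sat t\<close> is the task of stage \<open>t\<close> and \<open>good\<close>
  the relation required between all values. Only countably many values precede a stage, so
  \<open>step\<close> always applies.\<close>

lemma CH_recursion:
  fixes sat :: "real \<Rightarrow> 'c \<Rightarrow> bool" and good :: "'c \<Rightarrow> 'c \<Rightarrow> bool"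
  assumes CH
    and step: "\<And>\<A> t. countable \<A> \<Longrightarrow> (\<And>A B. A \<in> \<A> \<Longrightarrow> B \<in> \<A> \<Longrightarrow> good A B) \<Longrightarrow>
           \<exists>A. sat t A \<and> good A A \<and> (\<forall>B\<in>\<A>. good A B \<and> good B A)"
  obtains F where "\<And>t. sat t (F t)" "\<And>s t. good (F s) (F t)"
proof -
  obtain R :: "(real \<times> real) set" where wf: "wf R" and cnt: "\<And>t. countable {s. (s, t) \<in> R}"
    and tot: "\<And>s t. s \<noteq> t \<Longrightarrow> (s, t) \<in> R \<or> (t, s) \<in> R"
    using CH_countable_segments[OF \<open>CH\<close>] by metis
  define P where "P f t A \<longleftrightarrow> sat t A \<and> good A A \<and> (\<forall>s. (s, t) \<in> R \<longrightarrow> good A (f s) \<and> good (f s) A)"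
    for f t A
  have "\<exists>F. \<forall>t. P F t (F t)"
  proof (rule dependent_wf_choice[OF wf])
    fix f g :: "real \<Rightarrow> 'c" and t r
    assume "\<And>z. (z, t) \<in> R \<Longrightarrow> f z = g z"
    then show "P f t r = P g t r"
      unfolding P_def by auto
  next
    fix t and f :: "real \<Rightarrow> 'c"
    assume IH: "\<And>s. (s, t) \<in> R \<Longrightarrow> P f s (f s)"
    \<comment> \<open>Of two distinct earlier stages, the later value was chosen good with the
      earlier one in both directions; equal stages use \<open>good A A\<close>.\<close>
    have "good (f s) (f s')" if "(s, t) \<in> R" "(s', t) \<in> R" for s s'
      using IH[OF that(1)] IH[OF that(2)] tot[of s s'] unfolding P_def by metis
    then show "\<exists>r. P f t r"
      using step[of "f ` {s. (s, t) \<in> R}" t] cnt[of t] unfolding P_def by auto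
  qed
  then obtain F where F: "\<And>t. P F t (F t)"
    by blast
  show ?thesis
  proof
    show "sat t (F t)" for t
      using F[of t] by (simp add: P_def)
    show "good (F s) (F t)" for s t
      using F[of s] F[of t] tot[of s t] unfolding P_def by metis
  qed
qed

text \<open>A real codes a set of naturals, and every function occurs because its graph is such a
  set. Values of \<open>LEAST\<close> on sets that are not graphs are irrelevant.\<close>

lemma surj_real_nat_fun: "\<exists>\<phi> :: real \<Rightarrow> nat \<Rightarrow> nat. surj \<phi>"
proof -
  obtain b :: "real \<Rightarrow> nat set" where b: "bij b"
    using nat_sets_eqpoll_reals eqpoll_sym unfolding eqpoll_def by blast
  define \<phi> where "\<phi> t n = (LEAST m. prod_encode (n, m) \<in> b t)" for t n
  have "\<exists>t. k = \<phi> t" for k :: "nat \<Rightarrow> nat"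
  proof -
    obtain t where t: "b t = {prod_encode (n, k n) | n. True}"
      using surjD[OF bij_is_surj[OF b], of "{prod_encode (n, k n) | n. True}"] by metis
    have "\<phi> t = k"
      unfolding \<phi>_def t by (auto simp: Least_equality)
    then show ?thesis by blast
  qed
  then show ?thesis unfolding surj_def by blast
qed

section \<open>Ideals above BI\<close>

lemma ideal_subset: "is_ideal I \<Longrightarrow> A \<in> I \<Longrightarrow> B \<subseteq> A \<Longrightarrow> B \<in> I"
  by (auto simp: is_ideal_def)

lemma ideal_Un: "is_ideal I \<Longrightarrow> A \<in> I \<Longrightarrow> B \<in> I \<Longrightarrow> A \<union> B \<in> I"
  by (auto simp: is_ideal_def)

lemma ideal_finite: "is_ideal I \<Longrightarrow> finite F \<Longrightarrow> F \<subseteq> \<Union>I \<Longrightarrow> F \<in> I"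
  by (auto simp: is_ideal_def)

lemma ideal_UN_finite:
  assumes "is_ideal I" "finite F" "\<And>i. i \<in> F \<Longrightarrow> A i \<in> I"
  shows "(\<Union>i\<in>F. A i) \<in> I"
  using assms(2,3)
proof (induction F)
  case empty
  then show ?case
    using ideal_finite[OF assms(1), of "{}"] by simp
next
  case (insert i F)
  then show ?case
    using ideal_Un[OF assms(1), of "A i" "\<Union>i\<in>F. A i"] by simp
qed

text \<open>Along \<open>S\<close> each finite set of values is taken only finitely often; in this
  form convergence to the non-isolated points is obtained.\<close>

definition finite_to_one_on :: "('a \<Rightarrow> 'b) \<Rightarrow> 'a set \<Rightarrow> bool" where
  "finite_to_one_on f S \<longleftrightarrow> (\<forall>v. finite {d \<in> S. f d = v})"

lemma finite_to_one_onD: "finite_to_one_on f S \<Longrightarrow> finite V \<Longrightarrow> finite {d \<in> S. f d \<in> V}"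
proof -
  assume "finite_to_one_on f S" "finite V"
  moreover have "{d \<in> S. f d \<in> V} = (\<Union>v\<in>V. {d \<in> S. f d = v})"
    by blast
  ultimately show ?thesis
    by (simp add: finite_to_one_on_def)
qed

lemma finite_to_one_on_subset:
  assumes "finite_to_one_on f S" "T \<subseteq> S"
  shows "finite_to_one_on f T"
  unfolding finite_to_one_on_def
proof
  fix v
  have "finite {d \<in> S. f d = v}"
    using assms(1) by (simp add: finite_to_one_on_def)
  then show "finite {d \<in> T. f d = v}"
    by (rule rev_finite_subset) (use assms(2) in blast)
qed

lemma finite_to_one_on_factor:
  assumes "finite_to_one_on g S" "\<And>d. d \<in> S \<Longrightarrow> g d = \<psi> (f d)"
  shows "finite_to_one_on f S"
  unfolding finite_to_one_on_def
proof
  fix v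
  have "{d \<in> S. f d = v} \<subseteq> {d \<in> S. g d = \<psi> v}"
    using assms(2) by auto
  then show "finite {d \<in> S. f d = v}"
    using assms(1) finite_subset unfolding finite_to_one_on_def by blast
qed

text \<open>A set in \<^const>\<open>BI\<close> is covered by finitely many columns, finitely many sets with finite columns
  lying in a single row, and one set all of whose rows are finite.  An injection into
  \<open>\<omega>\<^sup>3\<close> pulling these back into \<open>I\<close> becomes a bijection after changing it on an infinite member
  of \<open>I\<close>.\<close>

lemma BI_sqsub_if_rows_columns:
  fixes y :: "'a \<Rightarrow> nat \<times> nat"
  assumes I: "is_ideal I"
    and fib: "\<And>p. {d \<in> \<Union>I. y d = p} \<in> I"
    and row: "\<And>i S. S \<subseteq> \<Union>I \<Longrightarrow> \<forall>d\<in>S. fst (y d) = i \<Longrightarrow> finite_to_one_on y S \<Longrightarrow> S \<in> I"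
    and rows: "\<And>S. S \<subseteq> \<Union>I \<Longrightarrow> finite_to_one_on (fst \<circ> y) S \<Longrightarrow> S \<in> I"
  shows "ideal_sqsub BI I"
proof -
  let ?X = "\<Union>I"
  have cX: "countable ?X" and XI: "?X \<notin> I"
    using I by (auto simp: is_ideal_def)
  let ?c = "to_nat_on ?X"
  \<comment> \<open>The code \<open>?c d\<close> in the third coordinate makes \<open>g\<close>
    injective, while the row and column of \<open>d\<close> are those given by
    \<open>y\<close>.\<close>
  define g where "g d = (fst (y d), snd (y d), ?c d)" for d
  have inj: "inj_on g ?X"
    using inj_on_to_nat_on[OF cX] by (auto simp: g_def inj_on_def)
  have pre: "{d \<in> ?X. g d \<in> B} \<in> I" if "B \<in> BI" for B
  proof -
    obtain k where k1: "\<And>i. i < k \<Longrightarrow> finite {j. infinite {l. (i, j, l) \<in> B}}"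
      and k2: "\<And>i. k \<le> i \<Longrightarrow> finite {(j, l). (i, j, l) \<in> B}"
    proof -
      obtain k where "\<forall>i. (i < k \<longrightarrow> {(j, l). (i, j, l) \<in> B} \<in> Fin2) \<and>
                     (k \<le> i \<longrightarrow> finite {(j, l). (i, j, l) \<in> B})"
        using \<open>B \<in> BI\<close> unfolding BI_def by blast
      with that[of k] show thesis
        by (simp add: Fin2_def)
    qed
    define N where "N i = {j. infinite {l. (i, j, l) \<in> B}}" for i
    let ?S1 = "\<Union>i\<in>{..<k}. \<Union>j\<in>N i. {d \<in> ?X. y d = (i, j)}"
    let ?T = "\<lambda>i. {d \<in> ?X. g d \<in> B \<and> fst (y d) = i \<and> snd (y d) \<notin> N i}"
    let ?S2 = "\<Union>i\<in>{..<k}. ?T i"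
    let ?S3 = "{d \<in> ?X. g d \<in> B \<and> k \<le> fst (y d)}"
    have fin: "finite {d \<in> ?X. g d \<in> Q}" if "finite Q" for Q
    proof -
      have "finite (g -` Q \<inter> ?X)"
        using finite_vimage_IntI[OF that inj] .
      then show ?thesis by (simp add: vimage_def Int_def conj_commute)
    qed
    have "?S1 \<in> I"
      by (intro ideal_UN_finite[OF I] fib) (auto simp: N_def k1)
    moreover have "?T i \<in> I" for i
    proof (rule row[of _ i])
      show "finite_to_one_on y (?T i)"
        unfolding finite_to_one_on_def
      proof
        fix p
        show "finite {d \<in> ?T i. y d = p}"
        proof (cases "fst p = i \<and> snd p \<notin> N i")
          case True
          have "finite {d \<in> ?X. g d \<in> (\<lambda>l. (i, snd p, l)) ` {l. (i, snd p, l) \<in> B}}"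
            using True by (intro fin) (auto simp: N_def)
          then show ?thesis
            by (rule rev_finite_subset) (auto simp: g_def)
        next
          case False
          then have "{d \<in> ?T i. y d = p} = {}" by auto
          then show ?thesis by (metis finite.emptyI)
        qed
      qed
    qed auto
    then have "?S2 \<in> I"
      by (intro ideal_UN_finite[OF I]) auto
    moreover have "?S3 \<in> I"
    proof (rule rows)
      show "finite_to_one_on (fst \<circ> y) ?S3"
        unfolding finite_to_one_on_def
      proof
        fix i
        show "finite {d \<in> ?S3. (fst \<circ> y) d = i}"
        proof (cases "k \<le> i")
          case True
          have "finite {d \<in> ?X. g d \<in> (\<lambda>(j, l). (i, j, l)) ` {(j, l). (i, j, l) \<in> B}}"
            using True by (intro fin finite_imageI k2)
          then show ?thesis
            by (rule rev_finite_subset) (auto simp: g_def)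
        next
          case False
          then have "{d \<in> ?S3. (fst \<circ> y) d = i} = {}" by auto
          then show ?thesis by (metis finite.emptyI)
        qed
      qed
    qed auto
    ultimately have "?S1 \<union> ?S2 \<union> ?S3 \<in> I"
      by (intro ideal_Un[OF I])
    moreover have "{d \<in> ?X. g d \<in> B} \<subseteq> ?S1 \<union> ?S2 \<union> ?S3"
    proof
      fix d assume "d \<in> {d \<in> ?X. g d \<in> B}"
      moreover obtain i j where "y d = (i, j)" by fastforce
      ultimately show "d \<in> ?S1 \<union> ?S2 \<union> ?S3"
        by (cases "i < k"; cases "j \<in> N i") auto
    qed
    ultimately show ?thesis
      by (rule ideal_subset[OF I])
  qed
  \<comment> \<open>If all members of \<open>I\<close> were finite, \<open>fib\<close>,
    \<open>row\<close> and \<open>rows\<close> would yield in turn finite columns, finite rows and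
    \<open>\<Union>I \<in> I\<close>.\<close>
  have "\<exists>Z\<in>I. infinite Z"
  proof (rule ccontr)
    assume "\<not> ?thesis"
    then have fin: "finite S" if "S \<in> I" for S
      using that by blast
    have "finite {d \<in> ?X. fst (y d) = i}" for i
    proof (intro fin row[of _ i])
      show "finite_to_one_on y {d \<in> ?X. fst (y d) = i}"
        unfolding finite_to_one_on_def
      proof
        fix p
        show "finite {d \<in> {d \<in> ?X. fst (y d) = i}. y d = p}"
          by (rule finite_subset[OF _ fin[OF fib[of p]]]) auto
      qed
    qed auto
    then have "?X \<in> I"
      by (intro rows) (auto simp: finite_to_one_on_def)
    with XI show False by simp
  qed
  then obtain Z where Z: "Z \<in> I" "infinite Z" by blast
  have ZX: "Z \<subseteq> ?X" using Z by blast
  \<comment> \<open>\<open>?W\<close> is what \<open>g\<close> does not hit from outside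
    \<open>Z\<close>. It contains the image of \<open>Z\<close>, so it is infinite and can be
    matched with \<open>Z\<close>; the new map differs from \<open>g\<close> only on
    \<open>Z\<close>, a member of \<open>I\<close>.\<close>
  let ?W = "UNIV - g ` (?X - Z)"
  have "g ` Z \<subseteq> ?W"
  proof (intro subsetI DiffI UNIV_I notI; elim imageE DiffE)
    fix p z x assume "p = g z" "z \<in> Z" "p = g x" "x \<in> ?X" "x \<notin> Z"
    then show False
      using inj_onD[OF inj, of z x] ZX by (metis subsetD)
  qed
  moreover have "infinite (g ` Z)"
    using Z(2) inj ZX finite_imageD inj_on_subset by blast
  ultimately have "infinite ?W"
    by (rule infinite_super)
  then have bijW: "bij_betw (from_nat_into ?W) UNIV ?W"
    by (intro bij_betw_from_nat_into) auto
  have "bij_betw (to_nat_on Z) Z UNIV"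
    using Z(2) countable_subset[OF ZX cX] by (intro to_nat_on_infinite)
  then obtain e where e: "bij_betw e Z ?W"
    using bij_betw_trans[OF _ bijW] by blast
  define f where "f d = (if d \<in> Z then e d else g d)" for d
  have "bij_betw f (Z \<union> (?X - Z)) (?W \<union> g ` (?X - Z))"
  proof (rule bij_betw_combine)
    show "bij_betw f Z ?W"
      using e by (auto simp: f_def cong: bij_betw_cong)
    show "bij_betw f (?X - Z) (g ` (?X - Z))"
      unfolding bij_betw_def using inj by (auto simp: f_def inj_on_def)
  qed auto
  moreover have "Z \<union> (?X - Z) = ?X" using ZX by blast
  moreover have "?W \<union> g ` (?X - Z) = \<Union>BI"
  proof -
    have "p \<in> \<Union>BI" for p
    proof (rule UnionI)
      obtain a b c where "p = (a, b, c)" by (metis prod_cases3)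
      then show "{p} \<in> BI"
        unfolding BI_def by (auto intro!: exI[of _ 0] finite_subset[of _ "{(b, c)}"])
    qed simp
    then have "\<Union>BI = UNIV" by blast
    then show ?thesis by simp
  qed
  moreover have "{d \<in> ?X. f d \<in> A} \<in> I" if "A \<in> BI" for A
    by (rule ideal_subset[OF I ideal_Un[OF I pre[OF that] Z(1)]]) (auto simp: f_def)
  ultimately show ?thesis
    unfolding ideal_sqsub_def by auto
qed

section \<open>Convergence in Mrowka spaces\<close>

lemma topspace_mrowka: "topspace (mrowka \<A>) = range MNat \<union> MSet ` \<A> \<union> {MInf}"
proof -
  have "MSet A \<in> \<Union>(mrowka_basis \<A>)" if "A \<in> \<A>" for A
    by (rule UnionI[of "insert (MSet A) (MNat ` (A - {}))"]) (use that in \<open>unfold mrowka_basis_def, blast+\<close>)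
  moreover have "MNat n \<in> \<Union>(mrowka_basis \<A>)" for n
    by (rule UnionI[of "{MNat n}"]) (auto simp: mrowka_basis_def)
  moreover have "MInf \<in> \<Union>(mrowka_basis \<A>)"
    by (rule UnionI[of "insert MInf (MSet ` (\<A> - {}) \<union> MNat ` (UNIV - ({} \<union> \<Union>{})))"])
      (unfold mrowka_basis_def, blast+)
  moreover have "\<Union>(mrowka_basis \<A>) \<subseteq> range MNat \<union> MSet ` \<A> \<union> {MInf}"
    by (auto simp: mrowka_basis_def)
  ultimately show ?thesis
    unfolding mrowka_def topology_generated_by_topspace by blast
qed

lemma openin_mrowka_MNat: "openin (mrowka \<A>) {MNat n}"
  unfolding mrowka_def by (rule topology_generated_by_Basis) (auto simp: mrowka_basis_def)

lemma openin_mrowka_MSet: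
  "A \<in> \<A> \<Longrightarrow> finite F \<Longrightarrow> openin (mrowka \<A>) (insert (MSet A) (MNat ` (A - F)))"
  unfolding mrowka_def by (rule topology_generated_by_Basis) (unfold mrowka_basis_def, blast)

lemma openin_mrowka_MInf:
  "finite F \<Longrightarrow> finite G \<Longrightarrow> G \<subseteq> \<A> \<Longrightarrow>
    openin (mrowka \<A>) (insert MInf (MSet ` (\<A> - G) \<union> MNat ` (UNIV - (F \<union> \<Union>G))))"
  unfolding mrowka_def by (rule topology_generated_by_Basis) (unfold mrowka_basis_def, blast)

text \<open>Having only finitely many terms outside a set that contains \<open>l\<close> passes to
  finite intersections and arbitrary unions, so the generating sets suffice.\<close>

lemma conv_on_mrowkaI:
  assumes l: "l \<in> topspace (mrowka \<A>)"
    and basis: "\<And>U. U \<in> mrowka_basis \<A> \<Longrightarrow> l \<in> U \<Longrightarrow> finite {d \<in> S. x d \<notin> U}"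
  shows "conv_on (mrowka \<A>) x S l"
proof -
  have "l \<in> U \<longrightarrow> finite {d \<in> S. x d \<notin> U}" if "generate_topology_on (mrowka_basis \<A>) U" for U
    using that
  proof induction
    case Empty
    then show ?case by simp
  next
    case (Int U V)
    show ?case
    proof
      assume "l \<in> U \<inter> V"
      then have "finite ({d \<in> S. x d \<notin> U} \<union> {d \<in> S. x d \<notin> V})"
        using Int.IH by simp
      then show "finite {d \<in> S. x d \<notin> U \<inter> V}"
        by (rule rev_finite_subset) auto
    qed
  next
    case (UN \<U>)
    show ?case
    proof
      assume "l \<in> \<Union>\<U>"
      then obtain U where U: "U \<in> \<U>" "l \<in> U" by blast
      then have "finite {d \<in> S. x d \<notin> U}"
        using UN.IH by blast
      then show "finite {d \<in> S. x d \<notin> \<Union>\<U>}"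
        by (rule rev_finite_subset) (use U in auto)
    qed
  next
    case (Basis U)
    then show ?case using basis by blast
  qed
  then show ?thesis
    using l by (simp add: conv_on_def mrowka_def openin_topology_generated_by_iff)
qed

lemma conv_on_const:
  assumes "l \<in> topspace X" "\<And>d. d \<in> S \<Longrightarrow> x d = l"
  shows "conv_on X x S l"
proof -
  have "{d \<in> S. x d \<notin> U} = {}" if "l \<in> U" for U
    using assms(2) that by auto
  then show ?thesis
    unfolding conv_on_def using assms(1) by (metis finite.emptyI)
qed

lemma conv_on_mrowka_MSet:
  assumes ad: "pairwise (\<lambda>A B. finite (A \<inter> B)) \<A>"
    and A: "A \<in> \<A>" and x: "\<And>d. d \<in> S \<Longrightarrow> x d \<in> MNat ` A" and fin: "finite_to_one_on x S"
  shows "conv_on (mrowka \<A>) x S (MSet A)"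
proof (rule conv_on_mrowkaI)
  show "MSet A \<in> topspace (mrowka \<A>)"
    using A by (simp add: topspace_mrowka)
  fix U assume U: "U \<in> mrowka_basis \<A>" "MSet A \<in> U"
  \<comment> \<open>A generating set containing \<open>MSet A\<close> can also be a neighbourhood of
    \<open>MInf\<close> with \<open>A\<close> outside \<open>G\<close>; then \<open>A\<close> meets
    each of the finitely many members of \<open>G\<close> in a finite set.\<close>
  have "finite {n \<in> A. MNat n \<notin> U}"
    using U(1) unfolding mrowka_basis_def
  proof (elim UnE)
    assume "U \<in> {{MNat n} | n. True}"
    then show ?thesis using U(2) by blast
  next
    assume "U \<in> {insert (MSet A) (MNat ` (A - F)) | A F. A \<in> \<A> \<and> finite F}"
    then obtain B F where F: "finite F" "U = insert (MSet B) (MNat ` (B - F))"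
      by blast
    then have "{n \<in> A. MNat n \<notin> U} \<subseteq> F"
      using U(2) by auto
    then show ?thesis
      using F(1) by (rule finite_subset)
  next
    assume "U \<in> {insert MInf (MSet ` (\<A> - G) \<union> MNat ` (UNIV - (F \<union> \<Union>G))) | F G.
        finite F \<and> finite G \<and> G \<subseteq> \<A>}"
    then obtain F G where G: "finite F" "finite G" "G \<subseteq> \<A>"
      and U_eq: "U = insert MInf (MSet ` (\<A> - G) \<union> MNat ` (UNIV - (F \<union> \<Union>G)))"
      by blast
    have "A \<notin> G"
      using U(2) U_eq by auto
    then have "finite (A \<inter> B)" if "B \<in> G" for B
      using pairwiseD[OF ad A, of B] G(3) that by auto
    then have "finite (F \<union> (\<Union>B\<in>G. A \<inter> B))"
      by (rule finite_UnI[OF G(1) finite_UN_I[OF G(2)]])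
    moreover have "{n \<in> A. MNat n \<notin> U} \<subseteq> F \<union> (\<Union>B\<in>G. A \<inter> B)"
      using U_eq by auto
    ultimately show ?thesis by (rule rev_finite_subset)
  qed
  then have "finite {d \<in> S. x d \<in> MNat ` {n \<in> A. MNat n \<notin> U}}"
    by (intro finite_to_one_onD[OF fin] finite_imageI)
  then show "finite {d \<in> S. x d \<notin> U}"
    by (rule rev_finite_subset) (use x in fastforce)
qed

text \<open>A generating set around \<open>MInf\<close> omits only finitely many points
  \<open>MSet A\<close>, and a finite-to-one sequence visits these finitely often.\<close>

lemma conv_on_mrowka_MInf:
  assumes x: "\<And>d. d \<in> S \<Longrightarrow> x d \<in> insert MInf (MSet ` \<A>)" and fin: "finite_to_one_on x S"
  shows "conv_on (mrowka \<A>) x S MInf"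
proof (rule conv_on_mrowkaI)
  show "MInf \<in> topspace (mrowka \<A>)"
    by (simp add: topspace_mrowka)
  fix U assume "U \<in> mrowka_basis \<A>" "MInf \<in> U"
  then obtain F G where G: "finite G" "U = insert MInf (MSet ` (\<A> - G) \<union> MNat ` (UNIV - (F \<union> \<Union>G)))"
    unfolding mrowka_basis_def by auto
  have "finite {d \<in> S. x d \<in> MSet ` G}"
    using G(1) by (intro finite_to_one_onD[OF fin] finite_imageI)
  then show "finite {d \<in> S. x d \<notin> U}"
  proof (rule rev_finite_subset)
    show "{d \<in> S. x d \<notin> U} \<subseteq> {d \<in> S. x d \<in> MSet ` G}"
      using x G(2) by blast
  qed
qed

text \<open>Points are separated case by case. For two members of \<open>\<A>\<close> the finite set
  \<open>A \<inter> B\<close> is removed from one neighbourhood; a member \<open>A\<close> is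
  separated from \<open>MInf\<close> by taking \<open>G = {A}\<close>.\<close>

lemma Hausdorff_mrowka:
  assumes ad: "pairwise (\<lambda>A B. finite (A \<inter> B)) \<A>"
  shows "Hausdorff_space (mrowka \<A>)"
proof -
  define sep where "sep p q \<longleftrightarrow> (\<exists>U V. openin (mrowka \<A>) U \<and> openin (mrowka \<A>) V \<and>
      p \<in> U \<and> q \<in> V \<and> disjnt U V)" for p q
  have sepI: "sep p q"
    if "openin (mrowka \<A>) U" "openin (mrowka \<A>) V" "p \<in> U" "q \<in> V" "disjnt U V" for p q U V
    unfolding sep_def using that by blast
  have sym: "sep q p" if "sep p q" for p q
    using that unfolding sep_def by (metis disjnt_sym)
  have NN: "sep (MNat n) (MNat m)" if "n \<noteq> m" for n m
    by (rule sepI[OF openin_mrowka_MNat[of _ n] openin_mrowka_MNat[of _ m]]) (use that in auto)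
  have NA: "sep (MNat n) (MSet A)" if "A \<in> \<A>" for n A
    by (rule sepI[OF openin_mrowka_MNat[of _ n] openin_mrowka_MSet[OF that, of "{n}"]])
      (auto simp: disjnt_def)
  have NI: "sep (MNat n) MInf" for n
    by (rule sepI[OF openin_mrowka_MNat[of _ n] openin_mrowka_MInf[of "{n}" "{}"]])
      (auto simp: disjnt_def)
  have AA: "sep (MSet A) (MSet B)" if "A \<in> \<A>" "B \<in> \<A>" "A \<noteq> B" for A B
    by (rule sepI[OF openin_mrowka_MSet[OF that(1), of "A \<inter> B"] openin_mrowka_MSet[OF that(2), of "{}"]])
      (use that pairwiseD[OF ad that] in \<open>auto simp: disjnt_def\<close>)
  have AI: "sep (MSet A) MInf" if "A \<in> \<A>" for A
    by (rule sepI[OF openin_mrowka_MSet[OF that, of "{}"] openin_mrowka_MInf[of "{}" "{A}"]])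
      (use that in \<open>auto simp: disjnt_def\<close>)
  have "sep p q" if "p \<in> topspace (mrowka \<A>)" "q \<in> topspace (mrowka \<A>)" "p \<noteq> q" for p q
    using that NN NA NI AA AI sym[OF NA] sym[OF NI] sym[OF AI]
    by (cases p; cases q) (simp_all add: topspace_mrowka image_iff)
  then show ?thesis
    unfolding Hausdorff_space_def sep_def by blast
qed

section \<open>Almost disjoint families capturing sequences\<close>

text \<open>\<open>K\<close> is the copy of \<open>J\<close> on \<omega>. The assumption
  \<open>avoid\<close> says that \<open>K\<close> is not Katetov below any restriction of
  \<open>I\<close> to a positive set; since \<open>\<Union>K\<close> is all of \<omega>, every
  \<open>f\<close> is an admissible map.\<close>

locale katetov_avoiding =
  fixes I :: "'a set set" and K :: "nat set set"
  assumes I: "is_ideal I" and unboring: "unboring I"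
    and K: "is_ideal K" and Union_K: "\<Union>K = UNIV"
    and avoid: "\<And>S f. S \<subseteq> \<Union>I \<Longrightarrow> S \<notin> I \<Longrightarrow> \<exists>B\<in>K. {d \<in> S. f d \<in> B} \<notin> I"
begin

lemma positive_infinite: "S \<subseteq> \<Union>I \<Longrightarrow> S \<notin> I \<Longrightarrow> infinite S"
  using ideal_finite[OF I] by blast

text \<open>Apply \<open>avoid\<close> to an injection of \<open>\<Union>I\<close> into
  \<open>N\<close>: a set of \<open>K\<close> with positive, hence infinite, preimage meets
  \<open>N\<close> in an infinite set.\<close>

lemma tall:
  assumes "infinite N"
  obtains B where "B \<in> K" "B \<subseteq> N" "infinite B"
proof -
  let ?X = "\<Union>I"
  have cX: "countable ?X" "?X \<notin> I"
    using I by (auto simp: is_ideal_def)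
  define f where "f = enumerate N \<circ> to_nat_on ?X"
  have inj: "inj_on f ?X"
    unfolding f_def using inj_on_to_nat_on[OF cX(1)] strict_mono_enumerate[OF assms]
    by (intro comp_inj_on) (auto intro: inj_on_subset strict_mono_imp_inj_on)
  have fN: "f d \<in> N" for d
    by (simp add: f_def assms enumerate_in_set)
  obtain B where B: "B \<in> K" "{d \<in> ?X. f d \<in> B} \<notin> I"
    using avoid[of ?X f] cX by auto
  have inf: "infinite {d \<in> ?X. f d \<in> B}"
    by (rule positive_infinite[OF _ B(2)]) auto
  have "inj_on f {d \<in> ?X. f d \<in> B}"
    using inj by (auto simp: inj_on_def)
  then have "infinite (f ` {d \<in> ?X. f d \<in> B})"
    using inf finite_imageD by blast
  moreover have "f ` {d \<in> ?X. f d \<in> B} \<subseteq> B \<inter> N"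
    using fN by auto
  ultimately have "infinite (B \<inter> N)"
    by (rule infinite_super[rotated])
  moreover have "B \<inter> N \<in> K"
    by (rule ideal_subset[OF K B(1)]) auto
  ultimately show ?thesis
    by (intro that[of "B \<inter> N"]) auto
qed

text \<open>The conditions on single sets are built in, so that one relation serves as
  \<open>good\<close> in the recursion; they concern \<open>A\<close> only, and
  \<open>compatible A A\<close> states just them.\<close>

definition compatible :: "nat set \<Rightarrow> nat set \<Rightarrow> bool" where
  "compatible A B \<longleftrightarrow> A \<in> K \<and> infinite A \<and> (A \<noteq> B \<longrightarrow> finite (A \<inter> B))"

text \<open>A sequence in the future space is coded by \<open>h\<close>: the value \<open>0\<close> marks the indices whose term
  is not in \<open>\<omega>\<close>, and \<open>Suc n\<close> stands for the term \<open>n\<close>.  In the second disjunct, \<open>c\<close> is a code of the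
  terms outside \<open>\<omega>\<close>, which are not known yet when \<open>A\<close> is chosen.\<close>

definition captures :: "('a \<Rightarrow> nat) \<Rightarrow> nat set \<Rightarrow> bool" where
  "captures h A \<longleftrightarrow>
     (\<exists>n. {d \<in> \<Union>I. h d = Suc n} \<notin> I) \<or>
     (\<forall>c :: 'a \<Rightarrow> nat. (\<forall>v. {d \<in> \<Union>I. h d = 0 \<and> c d = v} \<in> I) \<longrightarrow>
        (\<exists>S \<subseteq> \<Union>I. S \<notin> I \<and> (\<forall>d\<in>S. h d = 0) \<and> finite_to_one_on c S)) \<or>
     (\<exists>S \<subseteq> \<Union>I. S \<notin> I \<and> h ` S \<subseteq> Suc ` A \<and> finite_to_one_on h S)"

text \<open>If no \<open>A\<close> works, the map \<open>y\<close> below satisfies the hypotheses of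
  \<open>BI_sqsub_if_rows_columns\<close>: a positive set violating one of them would provide a
  capturing set, either an old member of \<open>\<A>\<close> or a new one almost disjoint from all
  of them.\<close>

lemma capturing_extension:
  assumes cnt: "countable \<A>" and ad: "\<And>A B. A \<in> \<A> \<Longrightarrow> B \<in> \<A> \<Longrightarrow> compatible A B"
  shows "\<exists>A. captures h A \<and> compatible A A \<and> (\<forall>B\<in>\<A>. compatible A B \<and> compatible B A)"
proof (rule ccontr)
  assume neg: "\<not> ?thesis"
  let ?X = "\<Union>I"
  \<comment> \<open>The first two disjuncts of \<open>captures\<close> do not mention the set, so
    their failure for a single candidate \<open>A0\<close> already gives \<open>hfib\<close> and the
    code \<open>c\<close>.\<close>
  have "\<exists>A. compatible A A \<and> (\<forall>B\<in>\<A>. compatible A B \<and> compatible B A)"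
  proof (cases "\<A> = {}")
    case True
    then show ?thesis
      using tall[of UNIV] by (auto simp: compatible_def)
  next
    case False
    then show ?thesis
      using ad by blast
  qed
  then obtain A0 where "\<not> captures h A0"
    using neg by blast
  then have hfib: "\<And>n. {d \<in> ?X. h d = Suc n} \<in> I"
    and "\<not> (\<forall>c :: 'a \<Rightarrow> nat. (\<forall>v. {d \<in> ?X. h d = 0 \<and> c d = v} \<in> I) \<longrightarrow>
        (\<exists>S \<subseteq> ?X. S \<notin> I \<and> (\<forall>d\<in>S. h d = 0) \<and> finite_to_one_on c S))"
    by (simp_all only: captures_def de_Morgan_disj not_ex not_not simp_thms)
  then obtain c :: "'a \<Rightarrow> nat" where c: "\<not> ((\<forall>v. {d \<in> ?X. h d = 0 \<and> c d = v} \<in> I) \<longrightarrow>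
        (\<exists>S \<subseteq> ?X. S \<notin> I \<and> (\<forall>d\<in>S. h d = 0) \<and> finite_to_one_on c S))"
    unfolding not_all by blast
  then have cfib: "{d \<in> ?X. h d = 0 \<and> c d = v} \<in> I" for v
    by (simp only: not_imp)
  have c1: "S \<in> I" if "S \<subseteq> ?X" "\<forall>d\<in>S. h d = 0" "finite_to_one_on c S" for S
    using c that by metis
  \<comment> \<open>The condition \<open>A \<noteq> B\<close> lets this cover both a new set and a
    member of \<open>\<A>\<close>.\<close>
  have none: "S \<in> I"
    if "compatible A A" "\<And>B. B \<in> \<A> \<Longrightarrow> A \<noteq> B \<Longrightarrow> finite (A \<inter> B)"
      "S \<subseteq> ?X" "h ` S \<subseteq> Suc ` A" "finite_to_one_on h S" for A S
  proof (rule ccontr)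
    assume "S \<notin> I"
    then have "captures h A"
      unfolding captures_def using that by blast
    moreover have "\<forall>B\<in>\<A>. compatible A B \<and> compatible B A"
      using that ad unfolding compatible_def by (metis inf_commute)
    ultimately show False
      using neg that(1) by blast
  qed
  have infinite_values: "infinite A"
    if "S \<subseteq> ?X" "S \<notin> I" "h ` S \<subseteq> Suc ` A" "finite_to_one_on h S" for A S
  proof
    assume "finite A"
    then have "finite {d \<in> S. h d \<in> Suc ` A}"
      by (intro finite_to_one_onD[OF that(4)]) simp
    moreover have "{d \<in> S. h d \<in> Suc ` A} = S"
      using that(3) by blast
    ultimately show False
      using positive_infinite[OF that(1,2)] by simp
  qed
  \<comment> \<open>Adding the empty set permits an enumeration even when \<open>\<A>\<close> is
    empty; it contains no \<open>n\<close>, so \<open>a (idx n)\<close> is a true member of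
    \<open>\<A>\<close> whenever \<open>n \<in> \<Union>\<A>\<close>.\<close>
  define a where "a = from_nat_into (insert {} \<A>)"
  have a: "range a = insert {} \<A>"
    unfolding a_def by (rule range_from_nat_into) (use cnt in auto)
  define idx where "idx n = (LEAST i. n \<in> a i)" for n
  have idx: "n \<in> a (idx n)" if n: "n \<in> \<Union>\<A>" for n
  proof -
    obtain A where "A \<in> range a" "n \<in> A"
      using n unfolding a by blast
    then obtain i where "n \<in> a i"
      by blast
    then show ?thesis
      unfolding idx_def by (rule LeastI)
  qed
  have idx_le: "idx n \<le> i" if "n \<in> a i" for n i
    unfolding idx_def using that by (rule Least_le)
  have inU: "n \<in> \<Union>\<A>" "a i \<in> \<A>" if "n \<in> a i" for n i
    using rangeI[of a i] that unfolding a by auto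
  \<comment> \<open>Row 0 holds the codes of terms outside \<omega> in even columns and the values
    outside \<open>\<Union>\<A>\<close> in odd columns. A value in \<open>\<Union>\<A>\<close> goes
    to the row of the first set containing it, shifted by one.\<close>
  define y where "y d = (case h d of 0 \<Rightarrow> (0, 2 * c d) |
      Suc n \<Rightarrow> if n \<in> \<Union>\<A> then (Suc (idx n), n) else (0, 2 * n + 1))" for d
  have y0: "y d = (0, 2 * c d)" if "h d = 0" for d
    using that by (simp add: y_def)
  have y1: "y d = (Suc (idx n), n)" if "h d = Suc n" "n \<in> \<Union>\<A>" for d n
    unfolding y_def using that by simp
  have y2: "y d = (0, 2 * n + 1)" if "h d = Suc n" "n \<notin> \<Union>\<A>" for d n
    unfolding y_def using that by simp
  have "ideal_sqsub BI I"
  proof (rule BI_sqsub_if_rows_columns[OF I])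
    fix p :: "nat \<times> nat"
    obtain i j where p: "p = (i, j)" by fastforce
    \<comment> \<open>Column \<open>j\<close> can come from a code or an uncovered value, both equal
      to \<open>j div 2\<close>, or from the covered value \<open>j\<close> itself.\<close>
    let ?U = "{d \<in> ?X. h d = 0 \<and> c d = j div 2} \<union> {d \<in> ?X. h d = Suc j} \<union> {d \<in> ?X. h d = Suc (j div 2)}"
    have "?U \<in> I"
      by (intro ideal_Un[OF I] hfib cfib)
    moreover have "{d \<in> ?X. y d = p} \<subseteq> ?U"
    proof
      fix d assume d: "d \<in> {d \<in> ?X. y d = p}"
      show "d \<in> ?U"
      proof (cases "h d")
        case 0
        then show ?thesis using d y0[of d] p by auto
      next
        case (Suc n)
        then show ?thesis using d y1[of d n] y2[of d n] p by (cases "n \<in> \<Union>\<A>") auto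
      qed
    qed
    ultimately show "{d \<in> ?X. y d = p} \<in> I"
      by (rule ideal_subset[OF I])
  next
    fix i S assume S: "S \<subseteq> ?X" "\<forall>d\<in>S. fst (y d) = i" "finite_to_one_on y S"
    show "S \<in> I"
    proof (cases i)
      case (Suc i')
      show ?thesis
      \<comment> \<open>In a row \<open>Suc i'\<close> the values lie in \<open>a i'\<close>, so
        this old set would capture \<open>h\<close>. An element of \<open>S\<close> is what shows
        that \<open>a i'\<close> is not the added empty set.\<close>
      proof (cases "S = {}")
        case True
        then show ?thesis using ideal_finite[OF I] by simp
      next
        case False
        have hS: "h d \<in> Suc ` a i'" if "d \<in> S" for d
        proof (cases "h d")
          case 0
          then show ?thesis using S(2) that y0 Suc by fastforce
        next
          case (Suc n)
          then show ?thesis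
            using S(2) that y1[of d n] y2[of d n] idx[of n] \<open>i = Suc i'\<close> by fastforce
        qed
        then have mem: "a i' \<in> \<A>"
          using False inU by blast
        have "y d = (i, h d - 1)" if d: "d \<in> S" for d
        proof -
          obtain n where "h d = Suc n" "n \<in> a i'"
            using hS[OF d] by blast
          then show ?thesis
            using y1[of d n] inU[of n i'] S(2) d by auto
        qed
        then have "finite_to_one_on h S"
          by (rule finite_to_one_on_factor[OF S(3)])
        then show ?thesis
          using none[of "a i'" S] mem ad hS S(1) by (auto simp: compatible_def image_subset_iff)
      qed
    next
      case 0
      let ?S0 = "{d \<in> S. h d = 0}"
      let ?S1 = "{d \<in> S. h d \<noteq> 0}"
      have S0_I: "?S0 \<in> I"
      proof (rule c1)
        show "finite_to_one_on c ?S0"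
          by (rule finite_to_one_on_factor[OF finite_to_one_on_subset[OF S(3)], where \<psi> = "\<lambda>v. (0, 2 * v)"])
            (auto simp: y0)
      qed (use S(1) in auto)
      have S1_I: "?S1 \<in> I"
      proof (rule ccontr)
        assume S1: "?S1 \<notin> I"
        have S1_sub: "?S1 \<subseteq> ?X"
          using S(1) by auto
        \<comment> \<open>\<open>avoid\<close> shrinks \<open>?S1\<close> to a positive part with
          values in a member \<open>B\<close> of \<open>K\<close>. These values lie outside
          \<open>\<Union>\<A>\<close>, so \<open>B - \<Union>\<A>\<close> contains them and is
          disjoint from every old set.\<close>
        obtain B where B: "B \<in> K" "{d \<in> ?S1. h d - 1 \<in> B} \<notin> I"
          by (rule bexE[OF avoid[OF S1_sub S1, of "\<lambda>d. h d - 1"]])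
        let ?S2 = "{d \<in> ?S1. h d - 1 \<in> B}"
        have S2_sub: "?S2 \<subseteq> ?X"
          using S(1) by auto
        let ?A = "B - \<Union>\<A>"
        have hS1: "\<exists>n. h d = Suc n \<and> n \<notin> \<Union>\<A>" if "d \<in> ?S1" for d
        proof (cases "h d")
          case (Suc n)
          have "n \<notin> \<Union>\<A>"
          proof
            assume "n \<in> \<Union>\<A>"
            then have "fst (y d) = Suc (idx n)"
              using y1[OF Suc] by simp
            then show False using S(2) 0 that by auto
          qed
          with Suc show ?thesis by blast
        qed (use that in simp)
        have hS2: "h ` ?S2 \<subseteq> Suc ` ?A"
        proof
          fix v assume "v \<in> h ` ?S2"
          then obtain d where d: "d \<in> ?S2" "v = h d" by blast
          then obtain n where "h d = Suc n" "n \<notin> \<Union>\<A>"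
            using hS1[of d] by blast
          then show "v \<in> Suc ` ?A" using d by auto
        qed
        have "finite_to_one_on h ?S2"
        proof (rule finite_to_one_on_factor[OF finite_to_one_on_subset[OF S(3)],
              where \<psi> = "\<lambda>v. (0, 2 * (v - 1) + 1)"])
          fix d assume "d \<in> ?S2"
          then obtain n where "h d = Suc n" "n \<notin> \<Union>\<A>"
            using hS1[of d] by blast
          then show "y d = (0, 2 * (h d - 1) + 1)"
            using y2[of d n] by simp
        qed auto
        moreover have "infinite ?A"
          using infinite_values[OF S2_sub B(2) hS2 calculation] .
        moreover have "?A \<in> K"
          by (rule ideal_subset[OF K B(1)]) auto
        moreover have "finite (?A \<inter> C)" if "C \<in> \<A>" for C
        proof -
          have "?A \<inter> C = {}" using that by blast
          then show ?thesis by (metis finite.emptyI)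
        qed
        ultimately have "?S2 \<in> I"
          using none[OF _ _ S2_sub hS2] by (simp only: compatible_def simp_thms)
        with B(2) show False by contradiction
      qed
      show ?thesis
        by (rule ideal_subset[OF I ideal_Un[OF I S0_I S1_I]]) auto
    qed
  next
    fix S assume S: "S \<subseteq> ?X" "finite_to_one_on (fst \<circ> y) S"
    let ?S0 = "{d \<in> S. (fst \<circ> y) d = 0}"
    let ?S1 = "{d \<in> S. (fst \<circ> y) d \<noteq> 0}"
    have S0_I: "?S0 \<in> I"
      using S by (intro ideal_finite[OF I]) (auto simp: finite_to_one_on_def)
    have S1_I: "?S1 \<in> I"
    proof (rule ccontr)
      assume S1: "?S1 \<notin> I"
      have S1_sub: "?S1 \<subseteq> ?X"
        using S(1) by auto
      obtain B where B: "B \<in> K" "{d \<in> ?S1. h d - 1 \<in> B} \<notin> I"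
        by (rule bexE[OF avoid[OF S1_sub S1, of "\<lambda>d. h d - 1"]])
      let ?S2 = "{d \<in> ?S1. h d - 1 \<in> B}"
        have S2_sub: "?S2 \<subseteq> ?X"
          using S(1) by auto
      \<comment> \<open>Here the candidate consists of exactly the values on \<open>?S2\<close>,
        since \<open>B\<close> itself may meet an old set in an infinite set.\<close>
      let ?A = "(\<lambda>d. h d - 1) ` ?S2"
      have hS1: "\<exists>n. h d = Suc n \<and> n \<in> \<Union>\<A>" if "d \<in> ?S1" for d
      proof (cases "h d")
        case 0
        then show ?thesis using that y0[of d] by simp
      next
        case (Suc n)
        then show ?thesis using that y2[of d n] by fastforce
      qed
      have fst_y: "(fst \<circ> y) d = Suc (idx (h d - 1))" if d: "d \<in> ?S1" for d
      proof -
        obtain n where "h d = Suc n" "n \<in> \<Union>\<A>"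
          using hS1[OF d] by blast
        then show ?thesis
          using y1[of d n] by simp
      qed
      have hS2: "h ` ?S2 \<subseteq> Suc ` ?A"
      proof
        fix v assume "v \<in> h ` ?S2"
        then obtain d where d: "d \<in> ?S2" "v = h d" by blast
        then obtain n where "h d = Suc n"
          using hS1[of d] by blast
        then have "v = Suc (h d - 1)" using d by simp
        then show "v \<in> Suc ` ?A" using d(1) by blast
      qed
      have ft: "finite_to_one_on (fst \<circ> y) ?S2"
        by (rule finite_to_one_on_subset[OF S(2)]) auto
      then have fth: "finite_to_one_on h ?S2"
        by (rule finite_to_one_on_factor[where \<psi> = "\<lambda>v. Suc (idx (v - 1))"]) (rule fst_y, simp)
      moreover have "infinite ?A"
        using infinite_values[OF S2_sub B(2) hS2 fth] .
      moreover have "?A \<in> K"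
        by (rule ideal_subset[OF K B(1)]) auto
      moreover have "finite (?A \<inter> C)" if C: "C \<in> \<A>" for C
      proof -
        obtain i where i: "C = a i"
          using C insertI2[of C \<A> "{}"] unfolding a[symmetric] by blast
        \<comment> \<open>A value in \<open>a i\<close> has first index at most \<open>i\<close>, so
          its indices lie in rows up to \<open>Suc i\<close>; each row contains only finitely many
          indices from \<open>?S2\<close>.\<close>
        have "?A \<inter> C \<subseteq> (\<lambda>d. h d - 1) ` {d \<in> ?S2. (fst \<circ> y) d \<in> {..Suc i}}"
        proof
          fix n assume n: "n \<in> ?A \<inter> C"
          then obtain d where d: "d \<in> ?S2" "n = h d - 1" by blast
          have "(fst \<circ> y) d = Suc (idx n)"
            using fst_y[of d] d by simp
          moreover have "idx n \<le> i"
            using n i idx_le by blast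
          ultimately show "n \<in> (\<lambda>d. h d - 1) ` {d \<in> ?S2. (fst \<circ> y) d \<in> {..Suc i}}"
            using d by auto
        qed
        moreover have "finite {d \<in> ?S2. (fst \<circ> y) d \<in> {..Suc i}}"
          by (rule finite_to_one_onD[OF ft]) simp
        ultimately show ?thesis
          by (rule finite_subset[OF _ finite_imageI])
      qed
      ultimately have "?S2 \<in> I"
        using none[OF _ _ S2_sub hS2] by (simp only: compatible_def simp_thms)
      with B(2) show False by contradiction
    qed
    show "S \<in> I"
      by (rule ideal_subset[OF I ideal_Un[OF I S0_I S1_I]]) auto
  qed
  with unboring show False
    by (simp add: unboring_def)
qed

section \<open>A maximal capturing family\<close>

lemma captures_cong:
  assumes "\<And>d. d \<in> \<Union>I \<Longrightarrow> h d = h' d"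
  shows "captures h A = captures h' A"
proof -
  have fibre: "{d \<in> \<Union>I. h d = Suc n} = {d \<in> \<Union>I. h' d = Suc n}"
    "{d \<in> \<Union>I. h d = 0 \<and> c d = v} = {d \<in> \<Union>I. h' d = 0 \<and> c d = v}" for n v :: nat and c
    by (intro Collect_cong conj_cong refl; simp only: assms)+
  have on: "(\<forall>d\<in>S. h d = 0) = (\<forall>d\<in>S. h' d = 0)" "h ` S = h' ` S"
    "finite_to_one_on h S = finite_to_one_on h' S" if "S \<subseteq> \<Union>I" for S
  proof -
    have eq: "h d = h' d" if "d \<in> S" for d
      using assms \<open>S \<subseteq> \<Union>I\<close> that by blast
    show "(\<forall>d\<in>S. h d = 0) = (\<forall>d\<in>S. h' d = 0)" "h ` S = h' ` S"
      "finite_to_one_on h S = finite_to_one_on h' S"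
      using eq by (simp_all add: finite_to_one_on_def cong: conj_cong)
  qed
  show ?thesis
    by (simp only: captures_def fibre on cong: conj_cong)
qed

text \<open>The recursion treats every code \<open>h\<close>, one at each real. Zorn's lemma then
  enlarges the range of \<open>F\<close> to a maximal family; capturing persists, and tallness of
  \<open>K\<close> turns maximality into the last property.\<close>

lemma maximal_capturing_family:
  assumes CH
  obtains \<A> where "\<And>A B. A \<in> \<A> \<Longrightarrow> B \<in> \<A> \<Longrightarrow> compatible A B"
    and "\<And>h. \<exists>A\<in>\<A>. captures h A"
    and "\<And>N. infinite N \<Longrightarrow> \<exists>A\<in>\<A>. infinite (A \<inter> N)"
proof -
  let ?X = "\<Union>I"
  obtain \<phi> :: "real \<Rightarrow> nat \<Rightarrow> nat" where \<phi>: "surj \<phi>"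
    using surj_real_nat_fun by blast
  obtain F where F: "\<And>t. captures (\<phi> t \<circ> to_nat_on ?X) (F t)" "\<And>s t. compatible (F s) (F t)"
    using CH_recursion[OF \<open>CH\<close>, of compatible "\<lambda>t. captures (\<phi> t \<circ> to_nat_on ?X)"] capturing_extension
    by metis
  have captured: "\<exists>t. captures h (F t)" for h
  proof -
    obtain t where t: "\<phi> t = h \<circ> from_nat_into ?X"
      using \<phi> by (metis surjD)
    have "(\<phi> t \<circ> to_nat_on ?X) d = h d" if "d \<in> ?X" for d
      using that I by (simp add: t is_ideal_def)
    then have "captures h (F t) = captures (\<phi> t \<circ> to_nat_on ?X) (F t)"
      by (rule captures_cong[symmetric])
    then show ?thesis
      using F(1) by blast
  qed
  define M where "M = {\<C>. range F \<subseteq> \<C> \<and> (\<forall>A\<in>\<C>. \<forall>B\<in>\<C>. compatible A B)}"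
  have "\<exists>\<A>\<in>M. \<forall>\<B>\<in>M. \<A> \<subseteq> \<B> \<longrightarrow> \<B> = \<A>"
  proof (rule subset_Zorn_nonempty)
    show "M \<noteq> {}"
      using F(2) unfolding M_def by blast
    fix \<C> assume C: "\<C> \<noteq> {}" "subset.chain M \<C>"
    have "compatible A B" if AB: "A \<in> \<Union>\<C>" "B \<in> \<Union>\<C>" for A B
    proof -
      obtain \<A> \<B> where m: "\<A> \<in> \<C>" "\<B> \<in> \<C>" "A \<in> \<A>" "B \<in> \<B>"
        using AB by blast
      then have "\<A> \<subseteq> \<B> \<or> \<B> \<subseteq> \<A>"
        using C(2) by (auto simp: subset_chain_def)
      moreover have "\<A> \<in> M" "\<B> \<in> M"
        using m C(2) by (auto simp: subset_chain_def)
      ultimately show ?thesis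
        using m unfolding M_def by blast
    qed
    moreover have "range F \<subseteq> \<Union>\<C>"
    proof -
      obtain \<A> where "\<A> \<in> \<C>" "\<A> \<in> M"
        using C by (auto simp: subset_chain_def)
      then show ?thesis
        unfolding M_def by blast
    qed
    ultimately show "\<Union>\<C> \<in> M"
      unfolding M_def by simp
  qed
  then obtain \<A> where AM: "\<A> \<in> M" and max: "\<And>\<B>. \<B> \<in> M \<Longrightarrow> \<A> \<subseteq> \<B> \<Longrightarrow> \<B> = \<A>"
    by blast
  have rangeF: "range F \<subseteq> \<A>" and compat: "\<And>A B. A \<in> \<A> \<Longrightarrow> B \<in> \<A> \<Longrightarrow> compatible A B"
    using AM unfolding M_def by blast+
  show thesis
  proof (rule that)
    show "\<exists>A\<in>\<A>. captures h A" for h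
      using captured rangeF by blast
    show "compatible A B" if "A \<in> \<A>" "B \<in> \<A>" for A B
      using compat that by blast
    show "\<exists>A\<in>\<A>. infinite (A \<inter> N)" if N: "infinite N" for N
    proof (rule ccontr)
      assume "\<not> ?thesis"
      then have fin: "finite (A \<inter> N)" if "A \<in> \<A>" for A
        using that by blast
      obtain B where B: "B \<in> K" "B \<subseteq> N" "infinite B"
        using tall[OF N] .
      have finB: "finite (A \<inter> B)" if "A \<in> \<A>" for A
        by (rule finite_subset[OF _ fin[OF that]]) (use B(2) in blast)
      \<comment> \<open>\<open>B\<close> lies in \<open>K\<close> and is almost disjoint from every
        member, so maximality puts it into \<open>\<A>\<close>, where it would be almost disjoint
        from itself.\<close>
      have "insert B \<A> \<in> M"
        using AM B finB unfolding M_def compatible_def by (auto simp: Int_commute)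
      then have "B \<in> \<A>"
        using max[of "insert B \<A>"] by blast
      then show False
        using finB[of B] B(3) by simp
    qed
  qed
qed

section \<open>Convergence along positive sets in the constructed space\<close>

text \<open>Unless the sequence is constant on a positive set, a set \<open>A\<close> capturing its
  code gives a positive set along which it converges to \<open>MInf\<close> (second disjunct of
  \<open>captures\<close>) or to \<open>MSet A\<close> (third disjunct).\<close>

lemma FinBW_mrowka:
  assumes compat: "\<And>A B. A \<in> \<A> \<Longrightarrow> B \<in> \<A> \<Longrightarrow> compatible A B"
    and capt: "\<And>h. \<exists>A\<in>\<A>. captures h A"
  shows "FinBW I (mrowka \<A>)"
  unfolding FinBW_def
proof (intro conjI allI impI)
  have ad: "pairwise (\<lambda>A B. finite (A \<inter> B)) \<A>"
    using compat by (auto simp: pairwise_def compatible_def)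
  then show "Hausdorff_space (mrowka \<A>)"
    by (rule Hausdorff_mrowka)
  let ?X = "\<Union>I"
  fix x assume x: "\<forall>d\<in>?X. x d \<in> topspace (mrowka \<A>)"
  define h where "h d = (case x d of MNat n \<Rightarrow> Suc n | _ \<Rightarrow> 0)" for d
  have h_Suc: "h d = Suc n \<longleftrightarrow> x d = MNat n" for d n
    by (cases "x d") (auto simp: h_def)
  have h_0: "x d \<in> insert MInf (MSet ` \<A>)" if "h d = 0" "d \<in> ?X" for d
  proof -
    have "x d \<in> topspace (mrowka \<A>)"
      using x that(2) by blast
    then show ?thesis
      using that(1) by (cases "x d") (auto simp: h_def topspace_mrowka)
  qed
  obtain A where A: "A \<in> \<A>" "captures h A"
    using capt by blast
  show "\<exists>S\<subseteq>?X. S \<notin> I \<and> (\<exists>l. conv_on (mrowka \<A>) x S l)"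
  proof (cases "\<exists>l\<in>topspace (mrowka \<A>). {d \<in> ?X. x d = l} \<notin> I")
    case True
    then obtain l where "l \<in> topspace (mrowka \<A>)" "{d \<in> ?X. x d = l} \<notin> I"
      by blast
    then show ?thesis
      by (intro exI[of _ "{d \<in> ?X. x d = l}"]) (auto intro!: conv_on_const)
  next
    case False
    then have fib: "{d \<in> ?X. x d = l} \<in> I" if "l \<in> topspace (mrowka \<A>)" for l
      using that by blast
    \<comment> \<open>Only now are the terms outside \<omega> known; \<open>c\<close> numbers the
      countably many values of \<open>x\<close>, so its fibres are fibres of \<open>x\<close> and
      belong to \<open>I\<close>.\<close>
    define c where "c = to_nat_on (x ` ?X) \<circ> x"
    have cnt: "countable (x ` ?X)"
      using I by (simp add: is_ideal_def)
    have c_eq: "c d = v \<longleftrightarrow> x d = from_nat_into (x ` ?X) v"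
      if "d \<in> ?X" "\<exists>d'\<in>?X. c d' = v" for d v
      using that cnt unfolding c_def by (metis comp_apply from_nat_into_to_nat_on imageI)
    have cfib: "{d \<in> ?X. h d = 0 \<and> c d = v} \<in> I" for v
    proof (cases "\<exists>d'\<in>?X. c d' = v")
      case True
      then obtain d' where d': "d' \<in> ?X" "c d' = v" by blast
      have "{d \<in> ?X. h d = 0 \<and> c d = v} \<subseteq> {d \<in> ?X. x d = x d'}"
        using c_eq[OF _ True] d' by auto
      then show ?thesis
        using ideal_subset[OF I fib] x d'(1) by blast
    next
      case False
      then have "{d \<in> ?X. h d = 0 \<and> c d = v} = {}" by blast
      then show ?thesis by (metis ideal_finite[OF I finite.emptyI] empty_subsetI)
    qed
    have hfib: "{d \<in> ?X. h d = Suc n} \<in> I" for n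
      using fib[of "MNat n"] by (simp add: h_Suc topspace_mrowka)
    consider S where "S \<subseteq> ?X" "S \<notin> I" "\<forall>d\<in>S. h d = 0" "finite_to_one_on c S"
      | S where "S \<subseteq> ?X" "S \<notin> I" "h ` S \<subseteq> Suc ` A" "finite_to_one_on h S"
      using A(2) unfolding captures_def
    proof (elim disjE)
      assume "\<exists>n. {d \<in> ?X. h d = Suc n} \<notin> I"
      then show thesis using hfib by simp
    next
      assume "\<forall>c :: 'a \<Rightarrow> nat. (\<forall>v. {d \<in> ?X. h d = 0 \<and> c d = v} \<in> I) \<longrightarrow>
        (\<exists>S \<subseteq> ?X. S \<notin> I \<and> (\<forall>d\<in>S. h d = 0) \<and> finite_to_one_on c S)"
      from mp[OF spec[OF this, of c] allI[OF cfib]] show thesis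
        using that(1) by blast
    next
      assume "\<exists>S \<subseteq> ?X. S \<notin> I \<and> h ` S \<subseteq> Suc ` A \<and> finite_to_one_on h S"
      then show thesis using that(2) by blast
    qed
    then show ?thesis
    proof cases
      case (1 S)
      have "finite_to_one_on x S"
        by (rule finite_to_one_on_factor[OF 1(4), of "to_nat_on (x ` ?X)"]) (simp add: c_def)
      then have "conv_on (mrowka \<A>) x S MInf"
        using 1 h_0 by (intro conv_on_mrowka_MInf) auto
      then show ?thesis using 1 by blast
    next
      case (2 S)
      have "finite_to_one_on x S"
        by (rule finite_to_one_on_factor[OF 2(4), of "\<lambda>p. case p of MNat n \<Rightarrow> Suc n | _ \<Rightarrow> 0"])
          (simp add: h_def)
      moreover have "x d \<in> MNat ` A" if "d \<in> S" for d
        using 2(3) that h_Suc by (metis image_iff subsetD)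
      ultimately have "conv_on (mrowka \<A>) x S (MSet A)"
        using ad A(1) by (intro conv_on_mrowka_MSet)
      then show ?thesis using 2 by blast
    qed
  qed
qed

text \<open>The union of a finite family would be in \<open>K\<close>, so its complement would be
  infinite and, by \<open>max\<close>, would meet some member.\<close>

lemma infinite_maximal_family:
  assumes compat: "\<And>A B. A \<in> \<A> \<Longrightarrow> B \<in> \<A> \<Longrightarrow> compatible A B"
    and max: "\<And>N. infinite N \<Longrightarrow> \<exists>A\<in>\<A>. infinite (A \<inter> N)"
  shows "infinite \<A>"
proof
  assume fin: "finite \<A>"
  have "(\<Union>A\<in>\<A>. A) \<in> K"
    using compat by (intro ideal_UN_finite[OF K fin]) (auto simp: compatible_def)
  then have UK: "\<Union>\<A> \<in> K" by simp
  have "infinite (UNIV - \<Union>\<A>)"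
  proof
    assume "finite (UNIV - \<Union>\<A>)"
    then have "UNIV - \<Union>\<A> \<in> K"
      by (intro ideal_finite[OF K]) (simp_all add: Union_K)
    from ideal_Un[OF K this UK] have "UNIV \<in> K"
      by (simp add: Un_commute)
    then show False
      using K Union_K by (simp add: is_ideal_def)
  qed
  from max[OF this] obtain A where "A \<in> \<A>" "infinite (A \<inter> (UNIV - \<Union>\<A>))"
    by blast
  moreover have "A \<inter> (UNIV - \<Union>\<A>) = {}"
    using \<open>A \<in> \<A>\<close> by blast
  ultimately show False by simp
qed

text \<open>A limit \<open>MNat m\<close> or \<open>MSet A\<close> would put \<open>N\<close> into
  \<open>K\<close> up to a finite set. For the limit \<open>MInf\<close>, \<open>max\<close> gives a
  member meeting \<open>N\<close> in an infinite set, and a neighbourhood of \<open>MInf\<close>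
  avoids that member.\<close>

lemma not_conv_on_mrowka_MNat:
  assumes compat: "\<And>A B. A \<in> \<A> \<Longrightarrow> B \<in> \<A> \<Longrightarrow> compatible A B"
    and max: "\<And>N. infinite N \<Longrightarrow> \<exists>A\<in>\<A>. infinite (A \<inter> N)"
    and N: "N \<notin> K"
  shows "\<not> conv_on (mrowka \<A>) MNat N l"
proof
  assume "conv_on (mrowka \<A>) MNat N l"
  then have l: "l \<in> topspace (mrowka \<A>)"
    and conv: "\<And>U. openin (mrowka \<A>) U \<Longrightarrow> l \<in> U \<Longrightarrow> finite {n \<in> N. MNat n \<notin> U}"
    by (auto simp: conv_on_def)
  have in_K: "N \<in> K" if "finite (N - B)" "B \<in> K" for B
  proof -
    have "N - B \<in> K"
      by (rule ideal_finite[OF K that(1)]) (simp add: Union_K)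
    then show ?thesis
      by (rule ideal_subset[OF K ideal_Un[OF K _ that(2)]]) auto
  qed
  have empty: "{} \<in> K"
    by (rule ideal_finite[OF K]) auto
  show False
  proof (cases l)
    case (MNat m)
    then have "finite {n \<in> N. n \<noteq> m}"
      using conv[OF openin_mrowka_MNat, of m] by simp
    moreover have "{m} \<in> K"
      by (rule ideal_finite[OF K]) (simp_all add: Union_K)
    ultimately show False
      using in_K[of "{m}"] N by (simp add: set_diff_eq)
  next
    case (MSet A)
    then have A: "A \<in> \<A>" using l by (auto simp: topspace_mrowka)
    have "finite {n \<in> N. MNat n \<notin> insert (MSet A) (MNat ` (A - {}))}"
      using MSet by (intro conv openin_mrowka_MSet[OF A]) simp_all
    moreover have "{n \<in> N. MNat n \<notin> insert (MSet A) (MNat ` (A - {}))} = N - A"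
      by auto
    ultimately show False
      using in_K[of A] compat[OF A A] N by (simp add: compatible_def)
  next
    case MInf
    have "infinite N"
      using in_K[of "{}"] empty N by auto
    then obtain A where A: "A \<in> \<A>" "infinite (A \<inter> N)"
      using max by blast
    have "finite {n \<in> N. MNat n \<notin> insert MInf (MSet ` (\<A> - {A}) \<union> MNat ` (UNIV - ({} \<union> \<Union>{A})))}"
      using MInf A(1) by (intro conv openin_mrowka_MInf) simp_all
    moreover have "{n \<in> N. MNat n \<notin> insert MInf (MSet ` (\<A> - {A}) \<union> MNat ` (UNIV - ({} \<union> \<Union>{A})))} = A \<inter> N"
      by auto
    ultimately show False using A(2) by simp
  qed
qed

end

section \<open>Transport of \<open>J\<close> to \<omega> and conclusion\<close>

lemma is_ideal_image:
  assumes J: "is_ideal J" and b: "bij_betw b (\<Union>J) Y"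
  shows "is_ideal ((`) b ` J)" "\<Union>((`) b ` J) = Y"
proof -
  have inj: "inj_on b (\<Union>J)" and im: "b ` \<Union>J = Y"
    using b by (auto simp: bij_betw_def)
  show UY: "\<Union>((`) b ` J) = Y"
    using im by blast
  have down: "B \<in> (`) b ` J" if A: "A \<in> J" and B: "B \<subseteq> b ` A" for A B
  proof -
    obtain C where "C \<subseteq> A" "B = b ` C"
      using B by (auto simp: subset_image_iff)
    then show ?thesis
      using ideal_subset[OF J A] by blast
  qed
  show "is_ideal ((`) b ` J)"
    unfolding is_ideal_def UY
  proof (intro conjI ballI allI impI)
    show "countable Y"
      using J im by (metis countable_image is_ideal_def)
    show "infinite Y"
      using J b by (metis bij_betw_finite is_ideal_def)
    show "B \<in> (`) b ` J" if "A \<in> (`) b ` J" "B \<subseteq> A" for A B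
      using that down by blast
    show "A \<union> B \<in> (`) b ` J" if AB: "A \<in> (`) b ` J" "B \<in> (`) b ` J" for A B
    proof -
      obtain A' B' where "A' \<in> J" "B' \<in> J" "A = b ` A'" "B = b ` B'"
        using AB by blast
      then show ?thesis
        using ideal_Un[OF J, of A' B'] by (metis image_Un image_eqI)
    qed
    show "F \<in> (`) b ` J" if F: "finite F \<and> F \<subseteq> Y" for F
    proof -
      obtain C where "C \<subseteq> \<Union>J" "finite C" "F = b ` C"
        using F im by (metis finite_subset_image)
      then show ?thesis
        using ideal_finite[OF J] by blast
    qed
    show "Y \<notin> (`) b ` J"
    proof
      assume "Y \<in> (`) b ` J"
      then obtain A where A: "A \<in> J" "b ` A = b ` \<Union>J"
        using im by auto
      then have "A = \<Union>J"
        using inj_on_image_eq_iff[OF inj, of A "\<Union>J"] by blast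
      with A(1) J show False
        by (simp add: is_ideal_def)
    qed
  qed
qed

theorem theorem9p1:
  fixes I :: "'a set set" and J :: "'b set set"
  assumes "CH"
    and "is_ideal I" and "is_ideal J"
    and "unboring I"
    and "\<forall>A. A \<subseteq> \<Union>I \<and> A \<notin> I \<longrightarrow> \<not> katetov_le J (restr_ideal I A)"
  shows "\<exists>\<A>. almost_disjoint_family \<A> \<and> FinBW I (mrowka \<A>) \<and> \<not> FinBW J (mrowka \<A>)"
proof -
  have "countable (\<Union>J)" "infinite (\<Union>J)"
    using assms(3) by (auto simp: is_ideal_def)
  then obtain b :: "'b \<Rightarrow> nat" where b: "bij_betw b (\<Union>J) UNIV"
    using to_nat_on_infinite by blast
  define K where "K = (`) b ` J"
  have K: "is_ideal K" "\<Union>K = UNIV"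
    unfolding K_def by (rule is_ideal_image[OF assms(3) b])+
  interpret katetov_avoiding I K
  proof
    fix S and f :: "'a \<Rightarrow> nat" assume S: "S \<subseteq> \<Union>I" "S \<notin> I"
    have US: "\<Union>(restr_ideal I S) = S"
      using S(1) unfolding restr_ideal_def by blast
    \<comment> \<open>Maps into \<omega> and maps into \<open>\<Union>J\<close> correspond through
      \<open>b\<close>, so a witness against \<open>?f\<close> yields its image under
      \<open>b\<close> as a witness against \<open>f\<close>.\<close>
    let ?f = "inv_into (\<Union>J) b \<circ> f"
    have f_mem: "?f d \<in> \<Union>J" for d
      using b by (metis UNIV_I bij_betw_imp_surj_on comp_apply inv_into_into)
    have bf: "b (?f d) = f d" for d
      using b by (metis UNIV_I bij_betw_inv_into_right comp_apply)
    have "katetov_le J (restr_ideal I S)" if "\<forall>B\<in>J. {d \<in> S. ?f d \<in> B} \<in> restr_ideal I S"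
      unfolding katetov_le_def US by (intro exI[of _ ?f] conjI ballI f_mem bspec[OF that])
    then obtain B where B: "B \<in> J" "{d \<in> S. ?f d \<in> B} \<notin> restr_ideal I S"
      using assms(5) S by metis
    have "{d \<in> S. f d \<in> b ` B} \<notin> I"
    proof
      assume "{d \<in> S. f d \<in> b ` B} \<in> I"
      then have "{d \<in> S. ?f d \<in> B} \<in> I"
        by (rule ideal_subset[OF assms(2)]) (use bf in \<open>auto simp: image_iff, metis\<close>)
      moreover have "{d \<in> S. ?f d \<in> B} = {d \<in> S. ?f d \<in> B} \<inter> S"
        by blast
      ultimately show False
        using B(2) unfolding restr_ideal_def by blast
    qed
    then show "\<exists>B\<in>K. {d \<in> S. f d \<in> B} \<notin> I"
      using B(1) unfolding K_def by blast
  qed (use assms K in auto)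
  obtain \<A> where compat: "\<And>A B. A \<in> \<A> \<Longrightarrow> B \<in> \<A> \<Longrightarrow> compatible A B"
    and capt: "\<And>h. \<exists>A\<in>\<A>. captures h A"
    and max: "\<And>N. infinite N \<Longrightarrow> \<exists>A\<in>\<A>. infinite (A \<inter> N)"
    using maximal_capturing_family[OF \<open>CH\<close>] by metis
  have "almost_disjoint_family \<A>"
    using infinite_maximal_family[OF compat max] compat
    unfolding almost_disjoint_family_def compatible_def by blast
  moreover have "FinBW I (mrowka \<A>)"
    using FinBW_mrowka[OF compat capt] .
  moreover have "\<not> FinBW J (mrowka \<A>)"
  proof
    assume "FinBW J (mrowka \<A>)"
    \<comment> \<open>The sequence \<open>MNat \<circ> b\<close> is the identity sequence of
      \<omega> reindexed by \<open>\<Union>J\<close>; a set outside \<open>J\<close> is carried by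
      \<open>b\<close> to a set outside \<open>K\<close>.\<close>
    then have "(\<forall>d\<in>\<Union>J. (MNat \<circ> b) d \<in> topspace (mrowka \<A>)) \<longrightarrow>
        (\<exists>S\<subseteq>\<Union>J. S \<notin> J \<and> (\<exists>l. conv_on (mrowka \<A>) (MNat \<circ> b) S l))"
      unfolding FinBW_def by (elim conjE allE)
    moreover have "\<forall>d\<in>\<Union>J. (MNat \<circ> b) d \<in> topspace (mrowka \<A>)"
      by (simp add: topspace_mrowka)
    ultimately obtain S l where S: "S \<subseteq> \<Union>J" "S \<notin> J"
      and conv: "conv_on (mrowka \<A>) (MNat \<circ> b) S l"
      by blast
    have "b ` S \<notin> K"
    proof
      assume "b ` S \<in> K"
      then obtain B where "B \<in> J" "b ` S = b ` B"
        unfolding K_def by blast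
      moreover from this have "S = B"
        using inj_on_image_eq_iff[of b "\<Union>J" S B] b S(1) by (auto simp: bij_betw_def)
      ultimately show False using S(2) by simp
    qed
    moreover have "conv_on (mrowka \<A>) MNat (b ` S) l"
    proof -
      have "{n \<in> b ` S. MNat n \<notin> U} = b ` {d \<in> S. (MNat \<circ> b) d \<notin> U}" for U
        by auto
      then show ?thesis
        using conv unfolding conv_on_def by simp
    qed
    ultimately show False
      using not_conv_on_mrowka_MNat[OF compat max] by blast
  qed
  ultimately show ?thesis by blast
qed

end
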